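(* Let $(I,\Sigma)$ be a $\sigma$-pair, and let $I_\Sigma$ be the sub-2-category of $I$ with the same objects as $I$, with 1-cells those in $\Sigma$, and with all 2-cells of $I$ between them. Then $(I,\Sigma)$ is $\sigma$-filtered if and only if $I_\Sigma$ is bifiltered and the inclusion $I_\Sigma \hookrightarrow I$ is $\sigma$-cofinal relatively to $\Sigma$ (that is, with respect to the class of all 1-cells of $I_\Sigma$ on the source, and the class $\Sigma$ on the target).
   Context: A 2-category means a strict 2-category. A $\sigma$-pair $(I,\Sigma)$ is a 2-category $I$ with a class $\Sigma$ of 1-cells of $I$ which contains the equivalences and is closed under composition and under invertible 2-cells. $(I,\Sigma)$ is $\sigma$-filtered if $I$ is non-empty and: (1) for any objects $i,i'$ there are $s : i \to i''$, $s' : i' \to i''$ both in $\Sigma$; (2) for any parallel 1-cells $d,s : i \rightrightarrows i'$ with $s\in\Sigma$ there exist $t : i' \to i''$ in $\Sigma$ and a 2-cell $\alpha : td \Rightarrow ts$, which can be chosen invertible whenever $d$ is also in $\Sigma$; (3) for any parallel 2-cells $\alpha,\alpha' : d \Rightarrow s : i \to i'$ with $s \in \Sigma$ there exists $f : i' \to i''$ in $\Sigma$ such that $f*\alpha = f*\alpha'$. $I$ is bifiltered if $(I,\text{all 1-cells})$ is $\sigma$-filtered, i.e. $I$ is non-empty and: any two objects $i,i'$ admit 1-cells $i\to i''\leftarrow i'$; for any parallel $d,d' : i \rightrightarrows i'$ there are $f : i'\to i''$ and an invertible 2-cell $fd \simeq fd'$; for any parallel 2-cells $\alpha,\alpha'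 : d \Rightarrow d' : i \to i'$ there is $f : i'\to i''$ with $f*\alpha=f*\alpha'$. Let $I$ be $\sigma$-filtered with respect to a class $\Sigma$, and let $J$ be a 2-category with a class $\Sigma'$ of 1-cells. A pseudofunctor $F : I \to J$ is $\sigma$-cofinal with respect to $\Sigma$ and $\Sigma'$ if: - for any object $j$ of $J$ there is some 1-cell $j \to F(i)$ in $\Sigma'$; - for any parallel pair $d,t : j \rightrightarrows F(i)$ with $t \in \Sigma'$ there are $s : i \to i'$ in $\Sigma$ and a 2-cell $\alpha : F(s)d \Rightarrow F(s)t$, which can be chosen invertible whenever $d$ is also in $\Sigma'$; - for any parallel 2-cells $\alpha,\alpha' : d \Rightarrow t : j \to F(i)$ with $t \in \Sigma'$ there is $s : i\to i'$ in $\Sigma$ such that $F(s)*\alpha = F(s)*\alpha'$. *)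

theory Defs
  imports Main
begin

record ('o, 'a, 'c) two_cat =
  Obj :: "'o set"
  Arr :: "'a set"
  Cell :: "'c set"
  Dom :: "'a \<Rightarrow> 'o"
  Cod :: "'a \<Rightarrow> 'o"
  Src :: "'c \<Rightarrow> 'a"
  Tgt :: "'c \<Rightarrow> 'a"
  Id1 :: "'o \<Rightarrow> 'a"
  Id2 :: "'a \<Rightarrow> 'c"
  comp1 :: "'a \<Rightarrow> 'a \<Rightarrow> 'a"  (infixr \<open>\<cdot>\<index>\<close> 75)
  vcomp :: "'c \<Rightarrow> 'c \<Rightarrow> 'c"  (infixr \<open>\<bullet>\<index>\<close> 65)
  hcomp :: "'c \<Rightarrow> 'c \<Rightarrow> 'c"  (infixr \<open>\<star>\<index>\<close> 70)

definition hom1 :: "('o, 'a, 'c) two_cat \<Rightarrow> 'o \<Rightarrow> 'o \<Rightarrow> 'a set" where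
  "hom1 C x y = {f \<in> Arr C. Dom C f = x \<and> Cod C f = y}"

definition hom2 :: "('o, 'a, 'c) two_cat \<Rightarrow> 'a \<Rightarrow> 'a \<Rightarrow> 'c set" where
  "hom2 C f g = {\<alpha> \<in> Cell C. Src C \<alpha> = f \<and> Tgt C \<alpha> = g}"

text \<open>All compositions are written in applicative order. The values of the operations on
  non-composable arguments, or outside the carriers, are irrelevant.\<close>

locale two_category =
  fixes C :: "('o, 'a, 'c) two_cat" (structure)
  assumes Dom_in: "f \<in> Arr C \<Longrightarrow> Dom C f \<in> Obj C"
    and Cod_in: "f \<in> Arr C \<Longrightarrow> Cod C f \<in> Obj C"
    and Src_in: "\<alpha> \<in> Cell C \<Longrightarrow> Src C \<alpha> \<in> Arr C"
    and Tgt_in: "\<alpha> \<in> Cell C \<Longrightarrow> Tgt C \<alpha> \<in> Arr C"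
    and Dom_Src: "\<alpha> \<in> Cell C \<Longrightarrow> Dom C (Src C \<alpha>) = Dom C (Tgt C \<alpha>)"
    and Cod_Src: "\<alpha> \<in> Cell C \<Longrightarrow> Cod C (Src C \<alpha>) = Cod C (Tgt C \<alpha>)"
    and Id1_in: "x \<in> Obj C \<Longrightarrow> Id1 C x \<in> hom1 C x x"
    and comp1_in: "\<lbrakk>g \<in> hom1 C y z; f \<in> hom1 C x y\<rbrakk> \<Longrightarrow> g \<cdot> f \<in> hom1 C x z"
    and comp1_assoc: "\<lbrakk>h \<in> hom1 C z w; g \<in> hom1 C y z; f \<in> hom1 C x y\<rbrakk>
      \<Longrightarrow> (h \<cdot> g) \<cdot> f = h \<cdot> (g \<cdot> f)"
    and comp1_Id1_left: "f \<in> hom1 C x y \<Longrightarrow> Id1 C y \<cdot> f = f"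
    and comp1_Id1_right: "f \<in> hom1 C x y \<Longrightarrow> f \<cdot> Id1 C x = f"
    and Id2_in: "f \<in> Arr C \<Longrightarrow> Id2 C f \<in> hom2 C f f"
    and vcomp_in: "\<lbrakk>\<beta> \<in> hom2 C g h; \<alpha> \<in> hom2 C f g\<rbrakk> \<Longrightarrow> \<beta> \<bullet> \<alpha> \<in> hom2 C f h"
    and vcomp_assoc: "\<lbrakk>\<gamma> \<in> hom2 C h k; \<beta> \<in> hom2 C g h; \<alpha> \<in> hom2 C f g\<rbrakk>
      \<Longrightarrow> (\<gamma> \<bullet> \<beta>) \<bullet> \<alpha> = \<gamma> \<bullet> (\<beta> \<bullet> \<alpha>)"
    and vcomp_Id2_left: "\<alpha> \<in> hom2 C f g \<Longrightarrow> Id2 C g \<bullet> \<alpha> = \<alpha>"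
    and vcomp_Id2_right: "\<alpha> \<in> hom2 C f g \<Longrightarrow> \<alpha> \<bullet> Id2 C f = \<alpha>"
    and hcomp_in: "\<lbrakk>g \<in> hom1 C y z; f \<in> hom1 C x y; \<beta> \<in> hom2 C g g'; \<alpha> \<in> hom2 C f f'\<rbrakk>
      \<Longrightarrow> \<beta> \<star> \<alpha> \<in> hom2 C (g \<cdot> f) (g' \<cdot> f')"
    and hcomp_assoc: "\<lbrakk>h \<in> hom1 C z w; g \<in> hom1 C y z; f \<in> hom1 C x y;
        \<gamma> \<in> hom2 C h h'; \<beta> \<in> hom2 C g g'; \<alpha> \<in> hom2 C f f'\<rbrakk>
      \<Longrightarrow> (\<gamma> \<star> \<beta>) \<star> \<alpha> = \<gamma> \<star> (\<beta> \<star> \<alpha>)"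
    and hcomp_Id2_left: "\<lbrakk>f \<in> hom1 C x y; \<alpha> \<in> hom2 C f f'\<rbrakk> \<Longrightarrow> Id2 C (Id1 C y) \<star> \<alpha> = \<alpha>"
    and hcomp_Id2_right: "\<lbrakk>f \<in> hom1 C x y; \<alpha> \<in> hom2 C f f'\<rbrakk> \<Longrightarrow> \<alpha> \<star> Id2 C (Id1 C x) = \<alpha>"
    and hcomp_Id2_Id2: "\<lbrakk>g \<in> hom1 C y z; f \<in> hom1 C x y\<rbrakk> \<Longrightarrow> Id2 C g \<star> Id2 C f = Id2 C (g \<cdot> f)"
    and interchange: "\<lbrakk>g \<in> hom1 C y z; f \<in> hom1 C x y;
        \<beta> \<in> hom2 C g g'; \<beta>' \<in> hom2 C g' g''; \<alpha> \<in> hom2 C f f'; \<alpha>' \<in> hom2 C f' f''\<rbrakk>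
      \<Longrightarrow> (\<beta>' \<bullet> \<beta>) \<star> (\<alpha>' \<bullet> \<alpha>) = (\<beta>' \<star> \<alpha>') \<bullet> (\<beta> \<star> \<alpha>)"

definition whisker :: "('o, 'a, 'c) two_cat \<Rightarrow> 'a \<Rightarrow> 'c \<Rightarrow> 'c" where
  "whisker C f \<alpha> = Id2 C f \<star>\<^bsub>C\<^esub> \<alpha>"

definition invertible2 :: "('o, 'a, 'c) two_cat \<Rightarrow> 'c \<Rightarrow> bool" where
  "invertible2 C \<alpha> \<longleftrightarrow> \<alpha> \<in> Cell C \<and>
     (\<exists>\<beta> \<in> hom2 C (Tgt C \<alpha>) (Src C \<alpha>).
        \<beta> \<bullet>\<^bsub>C\<^esub> \<alpha> = Id2 C (Src C \<alpha>) \<and> \<alpha> \<bullet>\<^bsub>C\<^esub> \<beta> = Id2 C (Tgt C \<alpha>))"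

definition iso1 :: "('o, 'a, 'c) two_cat \<Rightarrow> 'a \<Rightarrow> 'a \<Rightarrow> bool" where
  "iso1 C f g \<longleftrightarrow> (\<exists>\<alpha> \<in> hom2 C f g. invertible2 C \<alpha>)"

definition equivalence1 :: "('o, 'a, 'c) two_cat \<Rightarrow> 'a \<Rightarrow> bool" where
  "equivalence1 C f \<longleftrightarrow> f \<in> Arr C \<and>
     (\<exists>g \<in> hom1 C (Cod C f) (Dom C f).
        iso1 C (g \<cdot>\<^bsub>C\<^esub> f) (Id1 C (Dom C f)) \<and> iso1 C (f \<cdot>\<^bsub>C\<^esub> g) (Id1 C (Cod C f)))"

text \<open>The field \<open>F_comp F g f\<close> is the structure cell \<open>F g \<cdot> F f \<Rightarrow> F (g \<cdot> f)\<close>,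
  and \<open>F_unit F x\<close> is the structure cell from the identity of \<open>F x\<close> to \<open>F\<close> of
  the identity of \<open>x\<close>.\<close>

record ('o, 'a, 'c, 'p, 'b, 'd) pseudo =
  F_obj :: "'o \<Rightarrow> 'p"
  F_arr :: "'a \<Rightarrow> 'b"
  F_cell :: "'c \<Rightarrow> 'd"
  F_comp :: "'a \<Rightarrow> 'a \<Rightarrow> 'd"
  F_unit :: "'o \<Rightarrow> 'd"

locale pseudofunctor =
  source: two_category C + target: two_category D
  for C :: "('o, 'a, 'c) two_cat" and D :: "('p, 'b, 'd) two_cat" +
  fixes F :: "('o, 'a, 'c, 'p, 'b, 'd) pseudo"
  assumes F_obj_in: "x \<in> Obj C \<Longrightarrow> F_obj F x \<in> Obj D"
    and F_arr_in: "f \<in> hom1 C x y \<Longrightarrow> F_arr F f \<in> hom1 D (F_obj F x) (F_obj F y)"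
    and F_cell_in: "\<alpha> \<in> hom2 C f g \<Longrightarrow> F_cell F \<alpha> \<in> hom2 D (F_arr F f) (F_arr F g)"
    and F_cell_Id2: "f \<in> Arr C \<Longrightarrow> F_cell F (Id2 C f) = Id2 D (F_arr F f)"
    and F_cell_vcomp: "\<lbrakk>\<beta> \<in> hom2 C g h; \<alpha> \<in> hom2 C f g\<rbrakk>
      \<Longrightarrow> F_cell F (\<beta> \<bullet>\<^bsub>C\<^esub> \<alpha>) = F_cell F \<beta> \<bullet>\<^bsub>D\<^esub> F_cell F \<alpha>"
    and F_comp_in: "\<lbrakk>g \<in> hom1 C y z; f \<in> hom1 C x y\<rbrakk>
      \<Longrightarrow> F_comp F g f \<in> hom2 D (F_arr F g \<cdot>\<^bsub>D\<^esub> F_arr F f) (F_arr F (g \<cdot>\<^bsub>C\<^esub> f))"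
    and F_comp_invertible: "\<lbrakk>g \<in> hom1 C y z; f \<in> hom1 C x y\<rbrakk> \<Longrightarrow> invertible2 D (F_comp F g f)"
    and F_unit_in: "x \<in> Obj C
      \<Longrightarrow> F_unit F x \<in> hom2 D (Id1 D (F_obj F x)) (F_arr F (Id1 C x))"
    and F_unit_invertible: "x \<in> Obj C \<Longrightarrow> invertible2 D (F_unit F x)"
    and F_comp_natural: "\<lbrakk>g \<in> hom1 C y z; f \<in> hom1 C x y; \<beta> \<in> hom2 C g g'; \<alpha> \<in> hom2 C f f'\<rbrakk>
      \<Longrightarrow> F_comp F g' f' \<bullet>\<^bsub>D\<^esub> (F_cell F \<beta> \<star>\<^bsub>D\<^esub> F_cell F \<alpha>)
        = F_cell F (\<beta> \<star>\<^bsub>C\<^esub> \<alpha>) \<bullet>\<^bsub>D\<^esub> F_comp F g f"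
    and F_comp_assoc: "\<lbrakk>h \<in> hom1 C z w; g \<in> hom1 C y z; f \<in> hom1 C x y\<rbrakk>
      \<Longrightarrow> F_comp F (h \<cdot>\<^bsub>C\<^esub> g) f \<bullet>\<^bsub>D\<^esub> (F_comp F h g \<star>\<^bsub>D\<^esub> Id2 D (F_arr F f))
        = F_comp F h (g \<cdot>\<^bsub>C\<^esub> f) \<bullet>\<^bsub>D\<^esub> (Id2 D (F_arr F h) \<star>\<^bsub>D\<^esub> F_comp F g f)"
    and F_comp_unit_left: "f \<in> hom1 C x y
      \<Longrightarrow> F_comp F (Id1 C y) f \<bullet>\<^bsub>D\<^esub> (F_unit F y \<star>\<^bsub>D\<^esub> Id2 D (F_arr F f)) = Id2 D (F_arr F f)"
    and F_comp_unit_right: "f \<in> hom1 C x y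
      \<Longrightarrow> F_comp F f (Id1 C x) \<bullet>\<^bsub>D\<^esub> (Id2 D (F_arr F f) \<star>\<^bsub>D\<^esub> F_unit F x) = Id2 D (F_arr F f)"

locale sigma_pair = two_category I
  for I :: "('o, 'a, 'c) two_cat" +
  fixes \<Sigma> :: "'a set"
  assumes sigma_Arr: "\<Sigma> \<subseteq> Arr I"
    and sigma_equivalence: "equivalence1 I f \<Longrightarrow> f \<in> \<Sigma>"
    and sigma_comp: "\<lbrakk>g \<in> \<Sigma>; f \<in> \<Sigma>; Dom I g = Cod I f\<rbrakk> \<Longrightarrow> g \<cdot>\<^bsub>I\<^esub> f \<in> \<Sigma>"
    and sigma_iso: "\<lbrakk>f \<in> \<Sigma>; iso1 I f g\<rbrakk> \<Longrightarrow> g \<in> \<Sigma>"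

text \<open>The phrase ``there is a 2-cell, which can be chosen invertible whenever \<open>d\<close> is also in the
  class'' is read as one existential statement whose 2-cell is required to be invertible only under
  that extra hypothesis.\<close>

locale sigma_filtered = sigma_pair I \<Sigma>
  for I :: "('o, 'a, 'c) two_cat" and \<Sigma> :: "'a set" +
  assumes nonempty: "Obj I \<noteq> {}"
    and filtered_objects: "\<lbrakk>i \<in> Obj I; i' \<in> Obj I\<rbrakk>
      \<Longrightarrow> \<exists>i'' \<in> Obj I. (\<exists>s \<in> hom1 I i i''. s \<in> \<Sigma>) \<and> (\<exists>s' \<in> hom1 I i' i''. s' \<in> \<Sigma>)"
    and filtered_arrows: "\<lbrakk>d \<in> hom1 I i i'; s \<in> hom1 I i i'; s \<in> \<Sigma>\<rbrakk>
      \<Longrightarrow> \<exists>i'' \<in> Obj I. \<exists>t \<in> hom1 I i' i'' \<inter> \<Sigma>. \<exists>\<alpha> \<in> hom2 I (t \<cdot>\<^bsub>I\<^esub> d) (t \<cdot>\<^bsub>I\<^esub> s).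
            d \<in> \<Sigma> \<longrightarrow> invertible2 I \<alpha>"
    and filtered_cells: "\<lbrakk>d \<in> hom1 I i i'; s \<in> hom1 I i i'; s \<in> \<Sigma>;
        \<alpha> \<in> hom2 I d s; \<alpha>' \<in> hom2 I d s\<rbrakk>
      \<Longrightarrow> \<exists>i'' \<in> Obj I. \<exists>f \<in> hom1 I i' i'' \<inter> \<Sigma>. whisker I f \<alpha> = whisker I f \<alpha>'"

definition bifiltered :: "('o, 'a, 'c) two_cat \<Rightarrow> bool" where
  "bifiltered I \<longleftrightarrow> sigma_filtered I (Arr I)"

lemma sigma_pair_Arr:
  assumes "two_category I"
  shows "sigma_pair I (Arr I)"
proof -
  interpret two_category I by fact
  show ?thesis
  proof unfold_locales
    show "g \<cdot>\<^bsub>I\<^esub> f \<in> Arr I" if "g \<in> Arr I" "f \<in> Arr I" "Dom I g = Cod I f" for g f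
      using comp1_in[of g "Cod I f" "Cod I g" f "Dom I f"] that by (simp add: hom1_def)
    show "g \<in> Arr I" if "f \<in> Arr I" "iso1 I f g" for f g
      using that Tgt_in by (auto simp: iso1_def hom2_def)
  qed (auto simp: equivalence1_def)
qed

lemma bifiltered_iff:
  "bifiltered I \<longleftrightarrow> two_category I \<and> Obj I \<noteq> {} \<and>
    (\<forall>i \<in> Obj I. \<forall>i' \<in> Obj I. \<exists>i'' \<in> Obj I. hom1 I i i'' \<noteq> {} \<and> hom1 I i' i'' \<noteq> {}) \<and>
    (\<forall>i i'. \<forall>d \<in> hom1 I i i'. \<forall>d' \<in> hom1 I i i'.
      \<exists>i'' \<in> Obj I. \<exists>f \<in> hom1 I i' i''. iso1 I (f \<cdot>\<^bsub>I\<^esub> d) (f \<cdot>\<^bsub>I\<^esub> d')) \<and>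
    (\<forall>i i'. \<forall>d \<in> hom1 I i i'. \<forall>d' \<in> hom1 I i i'. \<forall>\<alpha> \<in> hom2 I d d'. \<forall>\<alpha>' \<in> hom2 I d d'.
      \<exists>i'' \<in> Obj I. \<exists>f \<in> hom1 I i' i''. whisker I f \<alpha> = whisker I f \<alpha>')"
  (is "_ \<longleftrightarrow> ?rhs")
proof -
  have eq: "hom1 I x y \<inter> Arr I = hom1 I x y" for x y
    by (auto simp: hom1_def)
  have mem: "f \<in> Arr I" if "f \<in> hom1 I x y" for f x y
    using that by (simp add: hom1_def)
  show ?thesis
  proof
    assume "bifiltered I"
    then interpret sigma_filtered I "Arr I" by (simp add: bifiltered_def)
    show ?rhs
    proof (intro conjI ballI allI)
      fix i i' assume "i \<in> Obj I" "i' \<in> Obj I"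
      then show "\<exists>i'' \<in> Obj I. hom1 I i i'' \<noteq> {} \<and> hom1 I i' i'' \<noteq> {}"
        using filtered_objects[of i i'] by blast
    next
      fix i i' d d' assume "d \<in> hom1 I i i'" "d' \<in> hom1 I i i'"
      then show "\<exists>i'' \<in> Obj I. \<exists>f \<in> hom1 I i' i''. iso1 I (f \<cdot>\<^bsub>I\<^esub> d) (f \<cdot>\<^bsub>I\<^esub> d')"
        using filtered_arrows[of d i i' d'] mem unfolding eq iso1_def by meson
    next
      fix i i' d d' \<alpha> \<alpha>'
      assume "d \<in> hom1 I i i'" "d' \<in> hom1 I i i'" "\<alpha> \<in> hom2 I d d'" "\<alpha>' \<in> hom2 I d d'"
      then show "\<exists>i'' \<in> Obj I. \<exists>f \<in> hom1 I i' i''. whisker I f \<alpha> = whisker I f \<alpha>'"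
        using filtered_cells[of d i i' d' \<alpha> \<alpha>'] mem unfolding eq by meson
    qed (fact two_category_axioms nonempty)+
  next
    assume R: ?rhs
    then interpret sigma_pair I "Arr I" by (blast intro: sigma_pair_Arr)
    show "bifiltered I" unfolding bifiltered_def
    proof (unfold_locales, unfold eq)
      show "Obj I \<noteq> {}" using R by blast
    next
      fix i i' assume "i \<in> Obj I" "i' \<in> Obj I"
      with R show "\<exists>i'' \<in> Obj I. (\<exists>s \<in> hom1 I i i''. s \<in> Arr I) \<and> (\<exists>s' \<in> hom1 I i' i''. s' \<in> Arr I)"
        using mem by blast
    next
      fix d i i' s assume "d \<in> hom1 I i i'" "s \<in> hom1 I i i'"
      with R show "\<exists>i'' \<in> Obj I. \<exists>t \<in> hom1 I i' i''. \<exists>\<alpha> \<in> hom2 I (t \<cdot>\<^bsub>I\<^esub> d) (t \<cdot>\<^bsub>I\<^esub> s).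
          d \<in> Arr I \<longrightarrow> invertible2 I \<alpha>"
        unfolding iso1_def by meson
    next
      fix d i i' s \<alpha> \<alpha>'
      assume "d \<in> hom1 I i i'" "s \<in> hom1 I i i'" "\<alpha> \<in> hom2 I d s" "\<alpha>' \<in> hom2 I d s"
      with R show "\<exists>i'' \<in> Obj I. \<exists>f \<in> hom1 I i' i''. whisker I f \<alpha> = whisker I f \<alpha>'"
        by meson
    qed
  qed
qed

locale sigma_cofinal =
  source: sigma_filtered I \<Sigma> + pseudofunctor I J F
  for I :: "('o, 'a, 'c) two_cat" and \<Sigma> :: "'a set"
    and J :: "('p, 'b, 'd) two_cat" and \<Sigma>' :: "'b set"
    and F :: "('o, 'a, 'c, 'p, 'b, 'd) pseudo" +
  assumes sigma'_Arr: "\<Sigma>' \<subseteq> Arr J"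
    and cofinal_objects: "j \<in> Obj J \<Longrightarrow> \<exists>i \<in> Obj I. \<exists>t \<in> hom1 J j (F_obj F i). t \<in> \<Sigma>'"
    and cofinal_arrows: "\<lbrakk>i \<in> Obj I; d \<in> hom1 J j (F_obj F i); t \<in> hom1 J j (F_obj F i); t \<in> \<Sigma>'\<rbrakk>
      \<Longrightarrow> \<exists>i' \<in> Obj I. \<exists>s \<in> hom1 I i i' \<inter> \<Sigma>.
            \<exists>\<alpha> \<in> hom2 J (F_arr F s \<cdot>\<^bsub>J\<^esub> d) (F_arr F s \<cdot>\<^bsub>J\<^esub> t). d \<in> \<Sigma>' \<longrightarrow> invertible2 J \<alpha>"
    and cofinal_cells: "\<lbrakk>i \<in> Obj I; d \<in> hom1 J j (F_obj F i); t \<in> hom1 J j (F_obj F i); t \<in> \<Sigma>';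
        \<alpha> \<in> hom2 J d t; \<alpha>' \<in> hom2 J d t\<rbrakk>
      \<Longrightarrow> \<exists>i' \<in> Obj I. \<exists>s \<in> hom1 I i i' \<inter> \<Sigma>.
            whisker J (F_arr F s) \<alpha> = whisker J (F_arr F s) \<alpha>'"

definition sub_two_cat :: "('o, 'a, 'c) two_cat \<Rightarrow> 'a set \<Rightarrow> ('o, 'a, 'c) two_cat" where
  "sub_two_cat I \<Sigma> = I\<lparr>Arr := \<Sigma>, Cell := {\<alpha> \<in> Cell I. Src I \<alpha> \<in> \<Sigma> \<and> Tgt I \<alpha> \<in> \<Sigma>}\<rparr>"

text \<open>The inclusion of \<open>sub_two_cat I \<Sigma>\<close> into \<open>I\<close> is strict, so its structure cells are
  identities. The data do not depend on \<open>\<Sigma>\<close>, which enters only as the source of the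
  pseudofunctor.\<close>

definition inclusion :: "('o, 'a, 'c) two_cat \<Rightarrow> ('o, 'a, 'c, 'o, 'a, 'c) pseudo" where
  "inclusion I = \<lparr>F_obj = (\<lambda>x. x), F_arr = (\<lambda>f. f), F_cell = (\<lambda>\<alpha>. \<alpha>),
     F_comp = (\<lambda>g f. Id2 I (g \<cdot>\<^bsub>I\<^esub> f)), F_unit = (\<lambda>x. Id2 I (Id1 I x))\<rparr>"

end

theory Submission
  imports Defs
begin

text \<open>The inclusion of \<open>I_\<Sigma>\<close> acts as the identity, so its cofinality
  conditions on 1-cells and on 2-cells are the second and third filteredness conditions of
  \<open>(I, \<Sigma>)\<close>; its condition on objects is met by identities, which lie in
  \<open>\<Sigma>\<close> because they are equivalences. Bifilteredness of \<open>I_\<Sigma>\<close>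
  gives non-emptiness and the first condition. Conversely, the filteredness conditions with both
  1-cells in \<open>\<Sigma>\<close> give bifilteredness: the 2-cells can then be chosen invertible,
  and they and their inverses stay in \<open>I_\<Sigma>\<close>, which is closed under composition
  and full on 2-cells. The rest is to check that \<open>I_\<Sigma>\<close> is a 2-category
  (\<open>two_category_sub_two_cat\<close>) and that the inclusion is a pseudofunctor
  (\<open>pseudofunctor_inclusion\<close>).\<close>

lemma sub_two_cat_simps [simp]:
  "Obj (sub_two_cat I \<Sigma>) = Obj I"
  "Arr (sub_two_cat I \<Sigma>) = \<Sigma>"
  "Cell (sub_two_cat I \<Sigma>) = {\<alpha> \<in> Cell I. Src I \<alpha> \<in> \<Sigma> \<and> Tgt I \<alpha> \<in> \<Sigma>}"
  "Dom (sub_two_cat I \<Sigma>) = Dom I"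
  "Cod (sub_two_cat I \<Sigma>) = Cod I"
  "Src (sub_two_cat I \<Sigma>) = Src I"
  "Tgt (sub_two_cat I \<Sigma>) = Tgt I"
  "Id1 (sub_two_cat I \<Sigma>) = Id1 I"
  "Id2 (sub_two_cat I \<Sigma>) = Id2 I"
  "comp1 (sub_two_cat I \<Sigma>) = comp1 I"
  "vcomp (sub_two_cat I \<Sigma>) = vcomp I"
  "hcomp (sub_two_cat I \<Sigma>) = hcomp I"
  "whisker (sub_two_cat I \<Sigma>) = whisker I"
  by (simp_all add: sub_two_cat_def whisker_def fun_eq_iff)

lemma inclusion_simps [simp]:
  "F_obj (inclusion I) x = x"
  "F_arr (inclusion I) f = f"
  "F_cell (inclusion I) \<alpha> = \<alpha>"
  "F_comp (inclusion I) g f = Id2 I (g \<cdot>\<^bsub>I\<^esub> f)"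
  "F_unit (inclusion I) x = Id2 I (Id1 I x)"
  by (simp_all add: inclusion_def)

lemma hom2_sub_two_cat:
  "hom2 (sub_two_cat I \<Sigma>) f g = (if f \<in> \<Sigma> \<and> g \<in> \<Sigma> then hom2 I f g else {})"
  by (auto simp: hom2_def)

lemma mem_hom2_sub_two_cat [simp]:
  "\<alpha> \<in> hom2 (sub_two_cat I \<Sigma>) f g \<longleftrightarrow> \<alpha> \<in> hom2 I f g \<and> f \<in> \<Sigma> \<and> g \<in> \<Sigma>"
  by (simp add: hom2_sub_two_cat)

text \<open>An inverse runs between the same two 1-cells, so fullness on 2-cells puts it in the
  sub-2-category.\<close>

lemma invertible2_sub_two_cat:
  assumes "\<alpha> \<in> hom2 I f g" "f \<in> \<Sigma>" "g \<in> \<Sigma>"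
  shows "invertible2 (sub_two_cat I \<Sigma>) \<alpha> \<longleftrightarrow> invertible2 I \<alpha>"
  using assms by (simp add: invertible2_def hom2_sub_two_cat)
    (simp add: hom2_def sub_two_cat_def)

context two_category
begin

text \<open>The axioms on horizontal composition type only the source 1-cells; this recovers the
  type of the targets.\<close>

lemma hom1_hom2:
  assumes "f \<in> hom1 C x y" "\<alpha> \<in> hom2 C f g"
  shows "g \<in> hom1 C x y"
  using assms Tgt_in[of \<alpha>] Dom_Src[of \<alpha>] Cod_Src[of \<alpha>] by (auto simp: hom1_def hom2_def)

lemma invertible2_Id2:
  assumes "f \<in> Arr C"
  shows "invertible2 C (Id2 C f)"
  using Id2_in[OF assms] vcomp_Id2_left[OF Id2_in[OF assms]]
  by (auto simp: invertible2_def hom2_def)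

lemma iso1_refl:
  assumes "f \<in> Arr C"
  shows "iso1 C f f"
  using Id2_in[OF assms] invertible2_Id2[OF assms] by (auto simp: iso1_def)

text \<open>The identity is its own quasi-inverse, with identity 2-cells as witnesses.\<close>

lemma equivalence1_Id1:
  assumes "x \<in> Obj C"
  shows "equivalence1 C (Id1 C x)"
proof -
  have id: "Id1 C x \<in> hom1 C x x" using assms by (rule Id1_in)
  then have "Id1 C x \<in> Arr C" by (simp add: hom1_def)
  with id show ?thesis
    using comp1_Id1_left[OF id] iso1_refl[of "Id1 C x"]
    by (auto simp: equivalence1_def hom1_def)
qed

end

context sigma_pair
begin

lemma mem_hom1_sub_two_cat [simp]:
  "f \<in> hom1 (sub_two_cat I \<Sigma>) x y \<longleftrightarrow> f \<in> hom1 I x y \<and> f \<in> \<Sigma>"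
  using sigma_Arr by (auto simp: hom1_def)

lemma hom1_sub_two_cat: "hom1 (sub_two_cat I \<Sigma>) x y = hom1 I x y \<inter> \<Sigma>"
  by auto

lemma Id1_sigma: "x \<in> Obj I \<Longrightarrow> Id1 I x \<in> \<Sigma>"
  by (intro sigma_equivalence equivalence1_Id1)

lemma sigma_comp_hom1: "\<lbrakk>g \<in> hom1 I y z; f \<in> hom1 I x y; g \<in> \<Sigma>; f \<in> \<Sigma>\<rbrakk> \<Longrightarrow> g \<cdot>\<^bsub>I\<^esub> f \<in> \<Sigma>"
  by (rule sigma_comp) (auto simp: hom1_def)

text \<open>All equations are inherited from \<open>I\<close>; what needs \<open>\<Sigma>\<close> is
  closure under identities and composites.\<close>

lemma two_category_sub_two_cat: "two_category (sub_two_cat I \<Sigma>)"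
proof (unfold_locales, goal_cases)
  \<comment> \<open>For \<open>\<beta> \<star> \<alpha>\<close> to be a cell of the sub-2-category,
    the target composite of \<open>g'\<close> and \<open>f'\<close> must lie in
    \<open>\<Sigma>\<close> too.\<close>
  case (17 g y z f x \<beta> g' \<alpha> f')
  then show ?case
    by (auto intro: hcomp_in sigma_comp_hom1 dest: hom1_hom2)
next
  case (18 h z w g y f x \<gamma> h' \<beta> g' \<alpha> f')
  then show ?case by (auto intro: hcomp_assoc)
next
  case (22 g y z f x \<beta> g' \<beta>' g'' \<alpha> f' \<alpha>' f'')
  then show ?case by (auto intro: interchange)
qed (use sigma_Arr in \<open>auto simp: Dom_in Cod_in Dom_Src Cod_Src Id1_in Id1_sigma comp1_in
    comp1_assoc comp1_Id1_left comp1_Id1_right Id2_in vcomp_in vcomp_assoc vcomp_Id2_left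
    vcomp_Id2_right hcomp_Id2_left hcomp_Id2_right hcomp_Id2_Id2 sigma_comp_hom1\<close>)

text \<open>With identity structure cells, coherence reduces to the unit laws, strict associativity,
  and the fact that horizontal composites of identity 2-cells are identities.\<close>

lemma pseudofunctor_inclusion: "pseudofunctor (sub_two_cat I \<Sigma>) I (inclusion I)"
proof -
  interpret sub: two_category "sub_two_cat I \<Sigma>" by (rule two_category_sub_two_cat)
  have Arr: "f \<in> Arr I" if "f \<in> hom1 I x y" for f x y
    using that by (simp add: hom1_def)
  have Id1_Arr: "Id1 I x \<in> Arr I" if "x \<in> Obj I" for x
    using Id1_in[OF that] by (rule Arr)
  show ?thesis
  proof (unfold_locales, goal_cases)
    case (10 g y z f x \<beta> g' \<alpha> f')
    then have "\<beta> \<star>\<^bsub>I\<^esub> \<alpha> \<in> hom2 I (g \<cdot>\<^bsub>I\<^esub> f) (g' \<cdot>\<^bsub>I\<^esub> f')"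
      by (auto intro: hcomp_in)
    then show ?case by (simp add: vcomp_Id2_left vcomp_Id2_right)
  next
    case (11 h z w g y f x)
    then have "g \<cdot>\<^bsub>I\<^esub> f \<in> hom1 I x z" "h \<cdot>\<^bsub>I\<^esub> g \<in> hom1 I y w"
      by (auto intro: comp1_in)
    with 11 show ?case
      by (auto simp: hcomp_Id2_Id2 comp1_assoc)
  next
    case (12 f x y)
    then have "f \<in> hom1 I x y" by simp
    then show ?case
      by (simp add: hcomp_Id2_left[OF _ Id2_in[OF Arr]] comp1_Id1_left
          vcomp_Id2_left[OF Id2_in[OF Arr]])
  next
    case (13 f x y)
    then have "f \<in> hom1 I x y" by simp
    then show ?case
      by (simp add: hcomp_Id2_right[OF _ Id2_in[OF Arr]] comp1_Id1_right
          vcomp_Id2_left[OF Id2_in[OF Arr]])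
  qed (use sigma_Arr in \<open>auto simp: Id1_Arr Id2_in invertible2_Id2 comp1_in[THEN Arr]
      vcomp_Id2_left[OF Id2_in]\<close>)
qed

end

theorem lemma2p2p6:
  fixes I :: "('o, 'a, 'c) two_cat" and \<Sigma> :: "'a set"
  assumes "sigma_pair I \<Sigma>"
  shows "sigma_filtered I \<Sigma> \<longleftrightarrow>
    bifiltered (sub_two_cat I \<Sigma>) \<and>
    sigma_cofinal (sub_two_cat I \<Sigma>) (Arr (sub_two_cat I \<Sigma>)) I \<Sigma> (inclusion I)"
  (is "_ \<longleftrightarrow> ?bifiltered \<and> ?cofinal")
proof -
  interpret sigma_pair I \<Sigma> by (fact assms)
  show ?thesis
  proof (intro iffI conjI)
    assume "sigma_filtered I \<Sigma>"
    then interpret sigma_filtered I \<Sigma> .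
    interpret sub: sigma_pair "sub_two_cat I \<Sigma>" "Arr (sub_two_cat I \<Sigma>)"
      by (intro sigma_pair_Arr two_category_sub_two_cat)
    interpret sub: sigma_filtered "sub_two_cat I \<Sigma>" "Arr (sub_two_cat I \<Sigma>)"
    proof (unfold_locales, goal_cases)
      case 1
      show ?case using nonempty by simp
    next
      case (2 i i')
      then show ?case using filtered_objects[of i i'] by auto
    next
      case (3 d i i' s)
      then have ds: "d \<in> hom1 I i i'" "s \<in> hom1 I i i'" "d \<in> \<Sigma>" "s \<in> \<Sigma>"
        by auto
      \<comment> \<open>Since \<open>d\<close> is in \<open>\<Sigma>\<close> as well, the 2-cell may
        be taken invertible.\<close>
      then obtain i'' t \<alpha> where t: "i'' \<in> Obj I" "t \<in> hom1 I i' i''" "t \<in> \<Sigma>"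
        and \<alpha>: "\<alpha> \<in> hom2 I (t \<cdot>\<^bsub>I\<^esub> d) (t \<cdot>\<^bsub>I\<^esub> s)" "invertible2 I \<alpha>"
        using filtered_arrows[of d i i' s] by blast
      \<comment> \<open>Closure under composition brings \<open>\<alpha>\<close> and its inverse
        into the sub-2-category.\<close>
      have "t \<cdot>\<^bsub>I\<^esub> d \<in> \<Sigma>" "t \<cdot>\<^bsub>I\<^esub> s \<in> \<Sigma>"
        using ds t sigma_comp_hom1 by blast+
      with \<alpha> have "\<alpha> \<in> hom2 (sub_two_cat I \<Sigma>) (t \<cdot>\<^bsub>I\<^esub> d) (t \<cdot>\<^bsub>I\<^esub> s)"
        and "invertible2 (sub_two_cat I \<Sigma>) \<alpha>"
        by (simp_all add: invertible2_sub_two_cat)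
      with t show ?case
        by (auto simp: hom1_sub_two_cat simp del: mem_hom2_sub_two_cat)
    next
      case (4 d i i' s \<alpha> \<alpha>')
      then show ?case using filtered_cells[of d i i' s \<alpha> \<alpha>'] by (auto simp: hom1_sub_two_cat)
    qed
    show ?bifiltered
      unfolding bifiltered_def by (fact sub.sigma_filtered_axioms)
    interpret pseudofunctor "sub_two_cat I \<Sigma>" I "inclusion I"
      by (rule pseudofunctor_inclusion)
    show ?cofinal
    proof (unfold_locales, goal_cases)
      case 1
      show ?case by (rule sigma_Arr)
    next
      case (2 j)
      \<comment> \<open>The witness is the identity of \<open>j\<close>, a 1-cell from
        \<open>j\<close> to its own image.\<close>
      then show ?case using Id1_in[of j] Id1_sigma[of j] by auto
    next
      case (3 i d j t)
      then show ?case using filtered_arrows[of d j i t] by (simp add: hom1_sub_two_cat)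
    next
      case (4 i d j t \<alpha> \<alpha>')
      then show ?case using filtered_cells[of d j i t \<alpha> \<alpha>'] by (simp add: hom1_sub_two_cat)
    qed
  next
    assume "?bifiltered \<and> ?cofinal"
    \<comment> \<open>\<open>sigma_cofinal\<close> carries filteredness of its source, here
      bifilteredness of \<open>I_\<Sigma>\<close>, available as \<open>cof.source\<close>.\<close>
    then interpret cof: sigma_cofinal "sub_two_cat I \<Sigma>" "Arr (sub_two_cat I \<Sigma>)" I \<Sigma> "inclusion I"
      by simp
    have Obj: "y \<in> Obj I" if "f \<in> hom1 I x y" for f x y
      using that Cod_in by (auto simp: hom1_def)
    show "sigma_filtered I \<Sigma>"
    proof (unfold_locales, goal_cases)
      case 1
      show ?case using cof.source.nonempty by simp
    next
      case (2 i i')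
      then show ?case using cof.source.filtered_objects[of i i'] by auto
    next
      case (3 d i i' s)
      \<comment> \<open>The codomain \<open>i'\<close> is read as the image of the object
        \<open>i'\<close> of \<open>I_\<Sigma>\<close>; \<open>d\<close> may be any 1-cell of
        \<open>I\<close>, as cofinality constrains only the second 1-cell to
        \<open>\<Sigma>\<close>.\<close>
      then show ?case
        using cof.cofinal_arrows[of i' d i s] Obj[of d i i'] by (simp add: hom1_sub_two_cat)
    next
      case (4 d i i' s \<alpha> \<alpha>')
      then show ?case
        using cof.cofinal_cells[of i' d i s \<alpha> \<alpha>'] Obj[of d i i'] by (simp add: hom1_sub_two_cat)
    qed
  qed
qed

end
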